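(* Let $M_\theta:\mathbb{R}^n\to\mathbb{R}^d$ be a (Borel measurable) noise-to-sample mapping and $r:\mathbb{R}^d\to\mathbb{R}$ a continuous reward function such that the composition $r\circ M_\theta:\mathbb{R}^n\to\mathbb{R}$ is differentiable and $L$-smooth, i.e. $\|\nabla (r\circ M_\theta)(z)-\nabla (r\circ M_\theta)(z')\|\le L\|z-z'\|$ for all $z\neq z'$ in $\mathbb{R}^n$. Let $\ell>0$ be a step size, and for each integer $t\ge 0$ let $g_t$ be the $t$-fold gradient ascent map and $p_t$ the distribution of $M_\theta(g_t(z))$ with $z\sim\mathcal{N}(0,I_n)$, as defined in the context. Then for every integer $t\ge 0$, $$\mathbb{E}_{x\sim p_{t+1}}[r(x)]\;\ge\;\mathbb{E}_{x\sim p_t}[r(x)]+\left(\ell-\frac{\ell^2L}{2}\right)\mathbb{E}_{z_0\sim\mathcal{N}(0,I_n)}\left[\left\|\nabla (r\circ M_\theta)(g_t(z_0))\right\|_2^2\right].$$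
   Context: $\|\cdot\|=\|\cdot\|_2$ is the Euclidean norm and $\mathcal{N}(0,I_n)$ is the standard Gaussian distribution on $\mathbb{R}^n$. The map $M_\theta$ sends a noise vector $z\in\mathbb{R}^n$ to a generated sample $M_\theta(z)\in\mathbb{R}^d$ ($\theta$ is a fixed parameter). One gradient ascent step with step size $\ell$ is the map $g:\mathbb{R}^n\to\mathbb{R}^n$, $g(z)=z+\ell\,\nabla (r\circ M_\theta)(z)$. Its iterates are $g_0=\mathrm{id}$ and $g_t(z)=g(g_{t-1}(z))$ for $t\ge 1$. For $t\ge 0$, $p_t$ denotes the distribution on $\mathbb{R}^d$ of the random vector $M_\theta(g_t(z))$ where $z\sim\mathcal{N}(0,I_n)$ (the pushforward of $\mathcal{N}(0,I_n)$ under $M_\theta\circ g_t$). *)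

theory Defs
  imports "HOL-Probability.Probability"
begin

definition std_gaussian :: "(real ^ 'n) measure" where
  "std_gaussian = density lborel (\<lambda>z. ennreal (\<Prod>i\<in>UNIV. std_normal_density (z $ i)))"

(* Meaningful only at points of differentiability; there the vector D is unique. *)
definition gradient :: "('a::euclidean_space \<Rightarrow> real) \<Rightarrow> 'a \<Rightarrow> 'a" where
  "gradient f z = (THE D. GDERIV f z :> D)"

definition ascent_step ::
  "real \<Rightarrow> (real ^ 'd \<Rightarrow> real) \<Rightarrow> (real ^ 'n \<Rightarrow> real ^ 'd) \<Rightarrow> real ^ 'n \<Rightarrow> real ^ 'n" where
  "ascent_step l r M z = z + l *\<^sub>R gradient (r \<circ> M) z"

definition ascent_iter ::
  "real \<Rightarrow> (real ^ 'd \<Rightarrow> real) \<Rightarrow> (real ^ 'n \<Rightarrow> real ^ 'd) \<Rightarrow> nat \<Rightarrow> real ^ 'n \<Rightarrow> real ^ 'n" where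
  "ascent_iter l r M t = ascent_step l r M ^^ t"

definition sample_dist ::
  "real \<Rightarrow> (real ^ 'd \<Rightarrow> real) \<Rightarrow> (real ^ 'n \<Rightarrow> real ^ 'd) \<Rightarrow> nat \<Rightarrow> (real ^ 'd) measure" where
  "sample_dist l r M t = distr std_gaussian borel (\<lambda>z. M (ascent_iter l r M t z))"

end

theory Submission
  imports Defs
begin

text \<open>
  A Lipschitz gradient gives the descent inequality
  \<open>f (z + v) \<ge> f z + v \<bullet> \<nabla>f z - L/2 \<parallel>v\<parallel>\<^sup>2\<close>; taking \<open>v = \<ell> \<nabla>f z\<close> at \<open>z = g\<^sub>t z\<^sub>0\<close> yields the claim
  pointwise in \<open>z\<^sub>0\<close>. It may be integrated because \<open>f\<close> and \<open>\<parallel>\<nabla>f\<parallel>\<^sup>2\<close> grow at most quadratically, the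
  iterates \<open>g\<^sub>t\<close> are Lipschitz, and the Gaussian has finite second moments.
\<close>

section \<open>Gradients, the descent inequality and quadratic growth\<close>

lemma gderiv_gradient:
  fixes f :: "'a::euclidean_space \<Rightarrow> real"
  assumes "f differentiable (at z)"
  shows "GDERIV f z :> gradient f z"
proof -
  obtain f' where f': "(f has_derivative f') (at z)"
    using assms by (auto simp: differentiable_def)
  \<comment> \<open>Riesz representation in coordinates: the values of \<open>f'\<close> on the
    basis are the coordinates of the gradient.\<close>
  define D where "D = (\<Sum>b\<in>Basis. f' b *\<^sub>R b)"
  have lin: "linear f'"
    using f' by (rule has_derivative_linear)
  have "f' h = h \<bullet> D" for h
  proof -
    have "f' h = f' (\<Sum>b\<in>Basis. (h \<bullet> b) *\<^sub>R b)"
      by (simp add: euclidean_representation)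
    also have "\<dots> = (\<Sum>b\<in>Basis. (h \<bullet> b) *\<^sub>R f' b)"
      using lin by (simp add: linear_sum linear_cmul)
    also have "\<dots> = h \<bullet> D"
      by (simp add: D_def inner_sum_right mult.commute)
    finally show ?thesis .
  qed
  then have "f' = (\<lambda>h. h \<bullet> D)"
    by blast
  then have D: "GDERIV f z :> D"
    using f' by (simp add: gderiv_def)
  \<comment> \<open>Since \<open>gradient\<close> is a definite description, uniqueness is required
    besides existence.\<close>
  have "E = D" if "GDERIV f z :> E" for E
  proof -
    have "(\<lambda>h. h \<bullet> E) = (\<lambda>h. h \<bullet> D)"
      using that D unfolding gderiv_def by (rule has_derivative_unique)
    then show ?thesis
      by (metis vector_eq_rdot inner_commute)
  qed
  with D show ?thesis
    unfolding gradient_def by (rule theI)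
qed

text \<open>Along the segment from \<open>z\<close> to \<open>z + v\<close>, the slope of
  \<open>f\<close> at time \<open>s\<close> falls below its initial value by at most
  \<open>L * s * (norm v)\<^sup>2\<close>, by Cauchy-Schwarz; accumulating this over
  \<open>s\<close> from 0 to 1 produces the factor \<open>L / 2\<close>.\<close>

lemma lipschitz_gradient_lower_bound:
  fixes f :: "'a::real_inner \<Rightarrow> real"
  assumes D: "\<And>z. GDERIV f z :> D z"
    and lip: "L-lipschitz_on UNIV D"
  shows "f (z + v) \<ge> f z + v \<bullet> D z - L / 2 * (norm v)\<^sup>2"
proof -
  \<comment> \<open>The last summand is the antiderivative of the bound on the slope deficit, so
    \<phi> is nondecreasing; comparing \<open>\<phi> 0\<close> with \<open>\<phi> 1\<close> replaces
    an integration over \<open>s\<close>.\<close>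
  define \<phi> where "\<phi> s = f (z + s *\<^sub>R v) - s * (v \<bullet> D z) + L / 2 * s\<^sup>2 * (norm v)\<^sup>2" for s
  have "\<exists>y. DERIV \<phi> s :> y \<and> y \<ge> 0" if "0 \<le> s" for s
  proof (intro exI conjI)
    let ?d = "v \<bullet> D (z + s *\<^sub>R v) - v \<bullet> D z + L * s * (norm v)\<^sup>2"
    have "((\<lambda>s. f (z + s *\<^sub>R v)) has_derivative (\<lambda>h. (h *\<^sub>R v) \<bullet> D (z + s *\<^sub>R v))) (at s)"
    proof (rule has_derivative_compose[where g = f])
      show "((\<lambda>s. z + s *\<^sub>R v) has_derivative (\<lambda>h. h *\<^sub>R v)) (at s)"
        by (auto intro!: derivative_eq_intros)
    qed (use D in \<open>simp add: gderiv_def\<close>)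
    then have "DERIV (\<lambda>s. f (z + s *\<^sub>R v)) s :> v \<bullet> D (z + s *\<^sub>R v)"
      by (simp add: has_field_derivative_def mult_commute_abs)
    then show "DERIV \<phi> s :> ?d"
      unfolding \<phi>_def by (auto intro!: derivative_eq_intros)
    have "\<bar>v \<bullet> (D (z + s *\<^sub>R v) - D z)\<bar> \<le> norm v * norm (D (z + s *\<^sub>R v) - D z)"
      by (rule Cauchy_Schwarz_ineq2)
    also have "\<dots> \<le> norm v * (L * norm (s *\<^sub>R v))"
      using lipschitz_onD[OF lip, of "z + s *\<^sub>R v" z]
      by (intro mult_left_mono) (auto simp: dist_norm)
    also have "\<dots> = L * s * (norm v)\<^sup>2"
      using that by (simp add: power2_eq_square)
    finally show "?d \<ge> 0"
      by (simp add: inner_diff_right)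
  qed
  then have "\<phi> 0 \<le> \<phi> 1"
    by (intro DERIV_nonneg_imp_nondecreasing[of 0 1 \<phi>]) (simp, blast)
  then show ?thesis
    by (simp add: \<phi>_def)
qed

text \<open>Compare with the value at 0 and use
  \<open>(a + b)\<^sup>2 \<le> 2 * a\<^sup>2 + 2 * b\<^sup>2\<close>.\<close>

lemma lipschitz_norm_square_growth:
  fixes g :: "'a::real_normed_vector \<Rightarrow> 'b::real_normed_vector"
  assumes "K-lipschitz_on UNIV g"
  shows "(norm (g z))\<^sup>2 \<le> 2 * (norm (g 0))\<^sup>2 + 2 * K\<^sup>2 * (norm z)\<^sup>2"
proof -
  have "norm (g z) \<le> norm (g 0) + norm (g z - g 0)"
    by (rule norm_triangle_sub)
  also have "\<dots> \<le> norm (g 0) + K * norm z"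
    using lipschitz_onD[OF assms, of z 0] by (simp add: dist_norm)
  finally have "(norm (g z))\<^sup>2 \<le> (norm (g 0) + K * norm z)\<^sup>2"
    by (intro power_mono) auto
  also have "\<dots> \<le> 2 * (norm (g 0))\<^sup>2 + 2 * (K * norm z)\<^sup>2"
    using sum_squares_bound[of "norm (g 0)" "K * norm z"] by (simp add: power2_sum)
  finally show ?thesis
    by (simp add: power_mult_distrib)
qed

text \<open>The descent inequality at base point 0, for both \<open>f\<close> and
  \<open>- f\<close>, bounds \<open>f\<close> from both sides. Absorbing the linear term into
  squares accounts for \<open>(norm (D 0))\<^sup>2\<close> and for the 1 in
  \<open>L / 2 + 1\<close>.\<close>

lemma lipschitz_gradient_quadratic_growth:
  fixes f :: "'a::real_inner \<Rightarrow> real"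
  assumes D: "\<And>z. GDERIV f z :> D z"
    and lip: "L-lipschitz_on UNIV D"
  shows "\<bar>f z\<bar> \<le> (\<bar>f 0\<bar> + (norm (D 0))\<^sup>2) + (L / 2 + 1) * (norm z)\<^sup>2"
proof -
  have "L-lipschitz_on UNIV (\<lambda>z. - D z)"
    using lip by simp
  from lipschitz_gradient_lower_bound[OF GDERIV_minus[OF D] this, of 0 z]
    lipschitz_gradient_lower_bound[OF D lip, of 0 z]
  have "\<bar>f z\<bar> \<le> \<bar>f 0\<bar> + \<bar>z \<bullet> D 0\<bar> + L / 2 * (norm z)\<^sup>2"
    by simp
  moreover have "\<bar>z \<bullet> D 0\<bar> \<le> (norm (D 0))\<^sup>2 + (norm z)\<^sup>2"
    using Cauchy_Schwarz_ineq2[of z "D 0"] sum_squares_bound[of "norm z" "norm (D 0)"]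
      zero_le_power2[of "norm z"] zero_le_power2[of "norm (D 0)"] norm_ge_zero[of z]
      mult_nonneg_nonneg[OF norm_ge_zero[of z] norm_ge_zero[of "D 0"]]
    by linarith
  ultimately show ?thesis
    by (simp add: algebra_simps)
qed

section \<open>Integrability under the standard Gaussian\<close>

lemma space_std_gaussian [simp]: "space std_gaussian = UNIV"
  by (simp add: std_gaussian_def)

lemma sets_std_gaussian [simp, measurable_cong]: "sets std_gaussian = sets borel"
  by (simp add: std_gaussian_def)

text \<open>Bridges two indexings: Lebesgue product integrals range over \<open>Basis\<close>, the
  Gaussian density over coordinates.\<close>

lemma prod_Basis_vec:
  fixes F :: "real ^ 'n \<Rightarrow> 'b::comm_monoid_mult"
  shows "(\<Prod>b\<in>Basis. F b) = (\<Prod>i\<in>UNIV. F (axis i 1))"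
proof -
  have "(Basis :: (real ^ 'n) set) = range (\<lambda>i. axis i 1)"
    by (auto simp: Basis_vec_def)
  moreover have "inj (\<lambda>i::'n. axis i (1::real))"
    by (auto simp: inj_on_def axis_eq_axis)
  ultimately show ?thesis
    by (metis (no_types, lifting) prod.reindex_cong)
qed

text \<open>Density and integrand both factor over the coordinates, so by Tonelli the integral of
  the absolute value is a product of finite one-dimensional integrals.\<close>

lemma integrable_std_gaussian_prod:
  fixes h :: "'n::finite \<Rightarrow> real \<Rightarrow> real"
  assumes [measurable]: "\<And>i. h i \<in> borel_measurable borel"
    and int: "\<And>i. integrable lborel (\<lambda>x. std_normal_density x * h i x)"
  shows "integrable std_gaussian (\<lambda>z. \<Prod>i\<in>UNIV. h i (z $ i))"
proof -
  define k where "k i x = std_normal_density x * h i x" for i x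
  have [measurable]: "k i \<in> borel_measurable borel" for i
    unfolding k_def by measurable
  \<comment> \<open>The factors must be indexed by basis vectors here; \<open>idx\<close> recovers
    the coordinate of such a vector.\<close>
  define idx where "idx b = (THE i. b = axis i (1::real))" for b :: "real ^ 'n"
  have idx: "idx (axis i 1) = i" for i
    by (auto simp: idx_def axis_eq_axis)
  have "(\<integral>\<^sup>+z. ennreal (norm (\<Prod>i\<in>UNIV. k i (z $ i))) \<partial>(lborel :: (real ^ 'n) measure))
      = (\<integral>\<^sup>+z. (\<Prod>b\<in>Basis. ennreal \<bar>k (idx b) (z \<bullet> b)\<bar>) \<partial>(lborel :: (real ^ 'n) measure))"
    by (simp add: prod_Basis_vec idx prod_ennreal abs_prod flip: cart_eq_inner_axis)
  also have "\<dots> = (\<Prod>b\<in>(Basis :: (real ^ 'n) set). \<integral>\<^sup>+x. ennreal \<bar>k (idx b) x\<bar> \<partial>lborel)"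
    by (rule nn_integral_lborel_prod) auto
  also have "\<dots> < \<infinity>"
    using int unfolding k_def
    by (simp add: less_top[symmetric] ennreal_prod_eq_top integrable_iff_bounded)
  finally have "integrable (lborel :: (real ^ 'n) measure) (\<lambda>z. \<Prod>i\<in>UNIV. k i (z $ i))"
    by (intro integrableI_bounded) auto
  then show ?thesis
    unfolding std_gaussian_def
    by (subst integrable_density) (auto simp: k_def prod.distrib intro!: prod_nonneg)
qed

lemma integrable_std_gaussian_const: "integrable (std_gaussian :: (real ^ 'n) measure) (\<lambda>z. c :: real)"
proof -
  have "integrable (std_gaussian :: (real ^ 'n) measure) (\<lambda>z. \<Prod>i\<in>(UNIV :: 'n set). 1 :: real)"
    by (rule integrable_std_gaussian_prod) (use integrable_std_normal_moment[of 0] in auto)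
  then have "integrable (std_gaussian :: (real ^ 'n) measure) (\<lambda>z. c * 1)"
    by (intro integrable_mult_right) simp
  then show ?thesis
    by simp
qed

lemma integrable_std_gaussian_norm_square:
  "integrable (std_gaussian :: (real ^ 'n) measure) (\<lambda>z. (norm z)\<^sup>2)"
proof -
  have "integrable (std_gaussian :: (real ^ 'n) measure) (\<lambda>z. (z $ j)\<^sup>2)" for j
  proof -
    \<comment> \<open>The square of one coordinate is written as a full product with exponent 0
      elsewhere, which reduces the claim to normal moments of orders 0 and 2.\<close>
    have "integrable (std_gaussian :: (real ^ 'n) measure)
        (\<lambda>z. \<Prod>i\<in>UNIV. (z $ i) ^ (if i = j then 2 else 0))"
      by (rule integrable_std_gaussian_prod) (auto intro: integrable_std_normal_moment)
    moreover have "(\<Prod>i\<in>UNIV. (z $ i) ^ (if i = j then 2 else 0)) = (z $ j)\<^sup>2" for z :: "real ^ 'n"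
      by (simp add: if_distrib cong: if_cong)
    ultimately show ?thesis
      by simp
  qed
  moreover have "(norm z)\<^sup>2 = (\<Sum>j\<in>UNIV. (z $ j)\<^sup>2)" for z :: "real ^ 'n"
    by (simp add: norm_vec_def L2_set_def sum_nonneg)
  ultimately show ?thesis
    by simp
qed

text \<open>The common criterion for the reward and for the squared gradient norm: domination by a
  quadratic, which the Gaussian integrates.\<close>

lemma integrable_std_gaussian_quadratic_growth:
  fixes f :: "real ^ 'n \<Rightarrow> real"
  assumes "f \<in> borel_measurable borel"
    and "\<And>z. \<bar>f z\<bar> \<le> a + b * (norm z)\<^sup>2"
  shows "integrable std_gaussian f"
proof (rule Bochner_Integration.integrable_bound)
  show "integrable (std_gaussian :: (real ^ 'n) measure) (\<lambda>z. a + b * (norm z)\<^sup>2)"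
    by (intro integrable_std_gaussian_const integrable_std_gaussian_norm_square
        Bochner_Integration.integrable_add integrable_mult_right)
  show "f \<in> borel_measurable std_gaussian"
    using assms(1) by measurable
  have "norm (f z) \<le> norm (a + b * (norm z)\<^sup>2)" for z
    using assms(2)[of z] by simp
  then show "AE z in std_gaussian. norm (f z) \<le> norm (a + b * (norm z)\<^sup>2)"
    by simp
qed

section \<open>Gradient ascent steps and the expected reward\<close>

lemma lipschitz_ascent_iter:
  fixes M :: "real ^ 'n \<Rightarrow> real ^ 'd"
  assumes "L-lipschitz_on UNIV (gradient (r \<circ> M))"
  shows "((1 + \<bar>l\<bar> * L) ^ t)-lipschitz_on UNIV (ascent_iter l r M t)"
proof (induction t)
  case 0
  then show ?case
    by (simp add: ascent_iter_def lipschitz_on_id id_def)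
next
  case (Suc t)
  \<comment> \<open>The identity contributes 1 and the scaled gradient
    \<open>\<bar>l\<bar> * L\<close>; composing steps multiplies the constants.\<close>
  have "(1 + \<bar>l\<bar> * L)-lipschitz_on UNIV (ascent_step l r M)"
    unfolding ascent_step_def using assms
    by (intro lipschitz_on_add lipschitz_on_id lipschitz_on_cmult)
  then have "(1 + \<bar>l\<bar> * L)-lipschitz_on (range (ascent_iter l r M t)) (ascent_step l r M)"
    by (rule lipschitz_on_subset) simp
  from lipschitz_on_compose[OF Suc.IH this] show ?case
    by (simp add: ascent_iter_def)
qed

text \<open>For a displacement of \<open>l\<close> times the gradient, the linear term gains
  \<open>l\<close> times the squared gradient norm and the smoothness penalty costs
  \<open>l\<^sup>2 * L / 2\<close> times it.\<close>

lemma ascent_step_lower_bound: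
  fixes M :: "real ^ 'n \<Rightarrow> real ^ 'd"
  assumes "\<And>z. (r \<circ> M) differentiable (at z)"
    and "L-lipschitz_on UNIV (gradient (r \<circ> M))"
  shows "r (M (ascent_step l r M z)) \<ge>
    r (M z) + (l - l\<^sup>2 * L / 2) * (norm (gradient (r \<circ> M) z))\<^sup>2"
proof -
  have "(r \<circ> M) (ascent_step l r M z) \<ge> (r \<circ> M) z
      + l *\<^sub>R gradient (r \<circ> M) z \<bullet> gradient (r \<circ> M) z
      - L / 2 * (norm (l *\<^sub>R gradient (r \<circ> M) z))\<^sup>2"
    unfolding ascent_step_def
    by (intro lipschitz_gradient_lower_bound gderiv_gradient assms)
  then show ?thesis
    by (simp add: power_mult_distrib algebra_simps flip: power2_norm_eq_inner)
qed

theorem theorem1: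
  fixes M :: "real ^ 'n \<Rightarrow> real ^ 'd" and r :: "real ^ 'd \<Rightarrow> real"
    and L l :: real and t :: nat
  assumes "M \<in> borel_measurable borel"
    and "continuous_on UNIV r"
    and "\<And>z. (r \<circ> M) differentiable (at z)"
    and "\<And>z z'. z \<noteq> z' \<Longrightarrow>
           norm (gradient (r \<circ> M) z - gradient (r \<circ> M) z') \<le> L * norm (z - z')"
    and "l > 0"
  shows "(\<integral>x. r x \<partial>sample_dist l r M (t + 1)) \<ge>
         (\<integral>x. r x \<partial>sample_dist l r M t) +
         (l - l\<^sup>2 * L / 2) *
           (\<integral>z. (norm (gradient (r \<circ> M) (ascent_iter l r M t z)))\<^sup>2 \<partial>std_gaussian)"
proof -
  let ?G = "gradient (r \<circ> M)" and ?g = "ascent_iter l r M"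
  note [measurable] = assms(1)
  have [measurable]: "r \<in> borel_measurable borel"
    using assms(2) by (rule borel_measurable_continuous_onI)
  \<comment> \<open>Any coordinate gives a unit vector distinct from 0; smoothness at these two
    points forces \<open>0 \<le> L\<close>, which \<open>lipschitz_on\<close> demands.\<close>
  obtain i :: 'n where True
    by simp
  have "0 \<le> L * norm (axis i 1 - 0 :: real ^ 'n)"
    using order_trans[OF norm_ge_zero assms(4)[of "axis i 1" 0]] by (simp add: axis_eq_0_iff)
  then have "0 \<le> L"
    by simp
  then have lip: "L-lipschitz_on UNIV ?G"
    \<comment> \<open>The hypothesis covers distinct points only; for equal points both sides
      vanish.\<close>
    using assms(4) by (intro lipschitz_onI) (metis dist_norm dist_self mult_zero_right order_refl)
  note lip_iter = lipschitz_ascent_iter[OF lip, of l]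
  have [measurable]: "?g s \<in> borel_measurable borel" for s
    using lip_iter by (intro borel_measurable_continuous_onI lipschitz_on_continuous_on)
  have [measurable]: "?G \<in> borel_measurable borel"
    using lip by (intro borel_measurable_continuous_onI lipschitz_on_continuous_on)

  have mean: "(\<integral>x. r x \<partial>sample_dist l r M s) = (\<integral>z. r (M (?g s z)) \<partial>std_gaussian)" for s
    unfolding sample_dist_def by (subst integral_distr) auto
  have int_r: "integrable std_gaussian (\<lambda>z. r (M (?g s z)))" for s
  proof (rule integrable_std_gaussian_quadratic_growth)
    let ?a = "\<bar>r (M 0)\<bar> + (norm (?G 0))\<^sup>2" and ?K = "(1 + \<bar>l\<bar> * L) ^ s"
    fix z
    \<comment> \<open>The reward grows quadratically in the iterate, and the squared norm of the
      iterate grows quadratically in the noise, so the composition stays quadratic.\<close>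
    have "\<bar>r (M (?g s z))\<bar> \<le> ?a + (L / 2 + 1) * (norm (?g s z))\<^sup>2"
      using lipschitz_gradient_quadratic_growth[OF gderiv_gradient[OF assms(3)] lip, of "?g s z"]
      by simp
    also have "\<dots> \<le> ?a + (L / 2 + 1) * (2 * (norm (?g s 0))\<^sup>2 + 2 * ?K\<^sup>2 * (norm z)\<^sup>2)"
      using \<open>0 \<le> L\<close> by (intro add_left_mono mult_left_mono lipschitz_norm_square_growth lip_iter) auto
    finally show "\<bar>r (M (?g s z))\<bar> \<le> (?a + (L / 2 + 1) * (2 * (norm (?g s 0))\<^sup>2))
        + ((L / 2 + 1) * (2 * ?K\<^sup>2)) * (norm z)\<^sup>2"
      by (simp add: algebra_simps)
  qed measurable
  have int_G: "integrable std_gaussian (\<lambda>z. (norm (?G (?g t z)))\<^sup>2)"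
  proof (rule integrable_std_gaussian_quadratic_growth)
    have "(L * (1 + \<bar>l\<bar> * L) ^ t)-lipschitz_on UNIV (\<lambda>z. ?G (?g t z))"
      by (rule lipschitz_on_compose2[OF lip_iter lipschitz_on_subset[OF lip]]) simp
    from lipschitz_norm_square_growth[OF this]
    show "\<bar>(norm (?G (?g t z)))\<^sup>2\<bar> \<le> 2 * (norm (?G (?g t 0)))\<^sup>2
        + 2 * (L * (1 + \<bar>l\<bar> * L) ^ t)\<^sup>2 * (norm z)\<^sup>2" for z
      by simp
  qed measurable

  \<comment> \<open>A Bochner integral defaults to 0 off the integrable functions, so merging the
    two integrals rests on \<open>int_r\<close> and \<open>int_G\<close>.\<close>
  have "(\<integral>x. r x \<partial>sample_dist l r M t)
      + (l - l\<^sup>2 * L / 2) * (\<integral>z. (norm (?G (?g t z)))\<^sup>2 \<partial>std_gaussian)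
      = (\<integral>z. r (M (?g t z)) + (l - l\<^sup>2 * L / 2) * (norm (?G (?g t z)))\<^sup>2 \<partial>std_gaussian)"
    using int_r int_G by (simp add: mean)
  also have "\<dots> \<le> (\<integral>z. r (M (?g (t + 1) z)) \<partial>std_gaussian)"
  proof (rule integral_mono)
    \<comment> \<open>The iterate \<open>?g (t + 1) z\<close> is one \<open>ascent_step\<close>
      applied to \<open>?g t z\<close>, so the one-step bound is used at that point.\<close>
    show "r (M (?g t z)) + (l - l\<^sup>2 * L / 2) * (norm (?G (?g t z)))\<^sup>2 \<le> r (M (?g (t + 1) z))" for z
      using ascent_step_lower_bound[OF assms(3) lip] by (simp add: ascent_iter_def)
  qed (use int_r int_G in auto)
  finally show ?thesis
    by (simp add: mean)
qed

end
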